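(* There is an algorithm which, given a function $\mu:2^{[m]}\to\mathbb{R}$ (accessed only through an evaluation oracle for its generating polynomial $g_\mu(x)=\sum_{S\subseteq[m]}\mu(S)\prod_{i\in S}x_i$), a cost vector $c\in\mathbb{Z}^m$ and a value $C\in\mathbb{Z}$, computes $$\sum_{S\subseteq[m]:\ c(S)\le C}\mu(S)$$ (the problem $\mathrm{BCount}[\mu,c,C]$) in time polynomial in $m$ and $\|c\|_1$.
   Context: $[m]=\{1,\dots,m\}$; for $c\in\mathbb{Z}^m$ and $S\subseteq[m]$, $c(S)=\sum_{i\in S}c_i$, and $\|c\|_1=\sum_i|c_i|$. An evaluation oracle for $g_\mu$ returns the exact value $g_\mu(x)$ for any queried $x\in\mathbb{R}^m$. Running time counts oracle calls and exact real arithmetic operations at unit cost. *)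

theory Defs
  imports Complex_Main "HOL-Computational_Algebra.Polynomial"
begin

section \<open>The counting problem\<close>

text \<open>Subsets of \<open>[m]\<close> are subsets of \<open>{1..m}\<close>. A function on subsets of \<open>[m]\<close>, a vector
  in \<open>\<int>\<^sup>m\<close> and a point of \<open>\<real>\<^sup>m\<close> are total functions of which only the values on subsets,
  respectively elements, of \<open>{1..m}\<close> are ever inspected.\<close>

definition gen_poly :: "nat \<Rightarrow> (nat set \<Rightarrow> real) \<Rightarrow> (nat \<Rightarrow> real) \<Rightarrow> real" where
  "gen_poly m \<mu> x = (\<Sum>S\<in>Pow {1..m}. \<mu> S * (\<Prod>i\<in>S. x i))"

definition BCount :: "nat \<Rightarrow> (nat set \<Rightarrow> real) \<Rightarrow> (nat \<Rightarrow> int) \<Rightarrow> int \<Rightarrow> real" where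
  "BCount m \<mu> c C = (\<Sum>S | S \<subseteq> {1..m} \<and> (\<Sum>i\<in>S. c i) \<le> C. \<mu> S)"

definition l1_norm :: "nat \<Rightarrow> (nat \<Rightarrow> int) \<Rightarrow> nat" where
  "l1_norm m c = (\<Sum>i=1..m. nat \<bar>c i\<bar>)"


section \<open>Real random access programs with an evaluation oracle\<close>

text \<open>Algorithms are programs of an imperative language with integer and real variables and
  (unbounded) arrays. Integers serve as input data, counters and array indices and support
  only addition, subtraction and comparison. Reals are exact and support the field operations
  and comparison. There is no rounding and no conversion between the two sorts, the only
  constants are integers, and the oracle is the only access to \<open>\<mu>\<close>.\<close>

datatype iexp =
    INum int
  | IVar string
  | IArr string iexp
  | IAdd iexp iexp
  | ISub iexp iexp

datatype rexp =
    RNum int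
  | RVar string
  | RArr string iexp
  | RAdd rexp rexp
  | RSub rexp rexp
  | RMul rexp rexp
  | RDiv rexp rexp

datatype bexp =
    ILess iexp iexp
  | RLess rexp rexp
  | BNot bexp
  | BAnd bexp bexp

datatype com =
    Skip
  | IAssign string iexp
  | IStore string iexp iexp
  | RAssign string rexp
  | RStore string iexp rexp
  | Query string string
  | Seq com com
  | If bexp com com
  | While bexp com

record state =
  ivar :: "string \<Rightarrow> int"
  iarr :: "string \<Rightarrow> int \<Rightarrow> int"
  rvar :: "string \<Rightarrow> real"
  rarr :: "string \<Rightarrow> int \<Rightarrow> real"

primrec ival :: "iexp \<Rightarrow> state \<Rightarrow> int" where
  "ival (INum k) s = k"
| "ival (IVar x) s = ivar s x"
| "ival (IArr a e) s = iarr s a (ival e s)"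
| "ival (IAdd e f) s = ival e s + ival f s"
| "ival (ISub e f) s = ival e s - ival f s"

text \<open>Division by zero yields zero, as everywhere in HOL. Since programs can test for zero, this
  convention adds no computational power.\<close>

primrec rval :: "rexp \<Rightarrow> state \<Rightarrow> real" where
  "rval (RNum k) s = of_int k"
| "rval (RVar x) s = rvar s x"
| "rval (RArr a e) s = rarr s a (ival e s)"
| "rval (RAdd e f) s = rval e s + rval f s"
| "rval (RSub e f) s = rval e s - rval f s"
| "rval (RMul e f) s = rval e s * rval f s"
| "rval (RDiv e f) s = rval e s / rval f s"

primrec bval :: "bexp \<Rightarrow> state \<Rightarrow> bool" where
  "bval (ILess e f) s \<longleftrightarrow> ival e s < ival f s"
| "bval (RLess e f) s \<longleftrightarrow> rval e s < rval f s"
| "bval (BNot b) s \<longleftrightarrow> \<not> bval b s"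
| "bval (BAnd b d) s \<longleftrightarrow> bval b s \<and> bval d s"

text \<open>Every node of an expression is charged one time unit, so that integer operations, memory
  accesses and comparisons count as well as real arithmetic.\<close>

primrec icost :: "iexp \<Rightarrow> nat" where
  "icost (INum k) = 1"
| "icost (IVar x) = 1"
| "icost (IArr a e) = 1 + icost e"
| "icost (IAdd e f) = 1 + icost e + icost f"
| "icost (ISub e f) = 1 + icost e + icost f"

primrec rcost :: "rexp \<Rightarrow> nat" where
  "rcost (RNum k) = 1"
| "rcost (RVar x) = 1"
| "rcost (RArr a e) = 1 + icost e"
| "rcost (RAdd e f) = 1 + rcost e + rcost f"
| "rcost (RSub e f) = 1 + rcost e + rcost f"
| "rcost (RMul e f) = 1 + rcost e + rcost f"
| "rcost (RDiv e f) = 1 + rcost e + rcost f"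

primrec bcost :: "bexp \<Rightarrow> nat" where
  "bcost (ILess e f) = 1 + icost e + icost f"
| "bcost (RLess e f) = 1 + rcost e + rcost f"
| "bcost (BNot b) = 1 + bcost b"
| "bcost (BAnd b d) = 1 + bcost b + bcost d"

text \<open>\<open>exec g A s n t\<close>: with oracle \<open>g\<close>, program \<open>A\<close> started in state \<open>s\<close> terminates in
  state \<open>t\<close> after \<open>n\<close> time units. \<open>Query x a\<close> evaluates \<open>g\<close> at the point whose \<open>i\<close>-th
  coordinate is entry \<open>i\<close> of the real array \<open>a\<close>, and stores the result in the real
  variable \<open>x\<close>.\<close>

inductive exec ::
  "((nat \<Rightarrow> real) \<Rightarrow> real) \<Rightarrow> com \<Rightarrow> state \<Rightarrow> nat \<Rightarrow> state \<Rightarrow> bool"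
  for g :: "(nat \<Rightarrow> real) \<Rightarrow> real" where
  Skip: "exec g Skip s 1 s"
| IAssign: "exec g (IAssign x e) s (1 + icost e)
    (s\<lparr>ivar := (ivar s)(x := ival e s)\<rparr>)"
| IStore: "exec g (IStore a e f) s (1 + icost e + icost f)
    (s\<lparr>iarr := (iarr s)(a := (iarr s a)(ival e s := ival f s))\<rparr>)"
| RAssign: "exec g (RAssign x e) s (1 + rcost e)
    (s\<lparr>rvar := (rvar s)(x := rval e s)\<rparr>)"
| RStore: "exec g (RStore a e f) s (1 + icost e + rcost f)
    (s\<lparr>rarr := (rarr s)(a := (rarr s a)(ival e s := rval f s))\<rparr>)"
| Query: "exec g (Query x a) s 1
    (s\<lparr>rvar := (rvar s)(x := g (\<lambda>i. rarr s a (int i)))\<rparr>)"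
| Seq: "exec g A s k t \<Longrightarrow> exec g B t l u \<Longrightarrow> exec g (Seq A B) s (k + l) u"
| IfTrue: "bval b s \<Longrightarrow> exec g A s k t \<Longrightarrow> exec g (If b A B) s (1 + bcost b + k) t"
| IfFalse: "\<not> bval b s \<Longrightarrow> exec g B s k t \<Longrightarrow> exec g (If b A B) s (1 + bcost b + k) t"
| WhileFalse: "\<not> bval b s \<Longrightarrow> exec g (While b A) s (1 + bcost b) s"
| WhileTrue: "bval b s \<Longrightarrow> exec g A s k t \<Longrightarrow> exec g (While b A) t l u \<Longrightarrow>
    exec g (While b A) s (1 + bcost b + k + l) u"

inductive_cases exec_SkipE: "exec g Skip s n t"
inductive_cases exec_IAssignE: "exec g (IAssign x e) s n t"
inductive_cases exec_IStoreE: "exec g (IStore a e f) s n t"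
inductive_cases exec_RAssignE: "exec g (RAssign x e) s n t"
inductive_cases exec_RStoreE: "exec g (RStore a e f) s n t"
inductive_cases exec_QueryE: "exec g (Query x a) s n t"
inductive_cases exec_SeqE: "exec g (Seq A B) s n t"
inductive_cases exec_IfE: "exec g (If b A B) s n t"
inductive_cases exec_WhileE: "exec g (While b A) s n t"

lemma exec_deterministic:
  assumes "exec g A s n t" and "exec g A s n' t'"
  shows "n' = n \<and> t' = t"
  using assms
proof (induction arbitrary: n' t' rule: exec.induct)
  case (Skip s)
  then show ?case by (elim exec_SkipE) simp
next
  case (IAssign x e s)
  then show ?case by (elim exec_IAssignE) simp
next
  case (IStore a e f s)
  then show ?case by (elim exec_IStoreE) simp
next
  case (RAssign x e s)
  then show ?case by (elim exec_RAssignE) simp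
next
  case (RStore a e f s)
  then show ?case by (elim exec_RStoreE) simp
next
  case (Query x a s)
  then show ?case by (elim exec_QueryE) simp
next
  case (Seq A s k t B l u)
  from Seq.prems show ?case
    by (rule exec_SeqE) (metis Seq.IH)
next
  case (IfTrue b s A k t B)
  from IfTrue.prems show ?case
    by (rule exec_IfE) (use IfTrue.hyps in \<open>auto dest!: IfTrue.IH\<close>)+
next
  case (IfFalse b s B k t A)
  from IfFalse.prems show ?case
    by (rule exec_IfE) (use IfFalse.hyps in \<open>auto dest!: IfFalse.IH\<close>)+
next
  case (WhileFalse b s A)
  from WhileFalse.prems show ?case
    by (rule exec_WhileE) (use WhileFalse.hyps in simp)+
next
  case (WhileTrue b s A k t l u)
  from WhileTrue.prems show ?case
    by (rule exec_WhileE) (use WhileTrue.hyps in \<open>auto dest!: WhileTrue.IH\<close>)+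
qed

definition input_state :: "nat \<Rightarrow> (nat \<Rightarrow> int) \<Rightarrow> int \<Rightarrow> state" where
  "input_state m c C =
    \<lparr>ivar = (\<lambda>_. 0)(''m'' := int m, ''C'' := C),
     iarr = (\<lambda>_ _. 0)(''c'' := (\<lambda>i. if 1 \<le> i \<and> i \<le> int m then c (nat i) else 0)),
     rvar = (\<lambda>_. 0),
     rarr = (\<lambda>_ _. 0)\<rparr>"

definition result :: "state \<Rightarrow> real" where
  "result s = rvar s ''out''"

text \<open>The value at \<open>(x, y)\<close> of a polynomial in two variables, represented as a polynomial in the
  first variable whose coefficients are polynomials in the second.\<close>

definition poly2 :: "nat poly poly \<Rightarrow> nat \<Rightarrow> nat \<Rightarrow> nat" where
  "poly2 p x y = poly (poly p (of_nat x)) y"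

end

theory Submission imports Defs begin

text \<open>Let \<open>N = \<parallel>c\<parallel>\<^sub>1\<close>. The function \<open>q(z) = z\<^sup>N g\<^sub>\<mu>(z\<^bsup>c\<^sub>1\<^esup>, \<dots>, z\<^bsup>c\<^sub>m\<^esup>)\<close> is a polynomial of degree at most \<open>2N\<close>
  whose coefficient at \<open>z\<^bsup>N+k\<^esup>\<close> is the sum of \<open>\<mu>(S)\<close> over \<open>c(S) = k\<close>, so the answer is a sum of
  lowest coefficients of \<open>q\<close>. The program never computes the coefficients of \<open>q\<close> by linear algebra:
  it keeps the values \<open>q(1), \<dots>, q(2N+1)\<close>, obtains \<open>q(0)\<close> from the vanishing of the
  \<open>(2N+1)\<close>-st finite difference, replaces \<open>q(z)\<close> by \<open>(q(z) - q(0))/z\<close> at these points, and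
  repeats.\<close>

section \<open>Timed weakest preconditions\<close>

text \<open>The existential quantifier demands termination. Since execution is deterministic,
  \<open>Q\<close> then holds of the only possible cost and final state, so this is total
  correctness with a time bound.\<close>

definition wp ::
  "((nat \<Rightarrow> real) \<Rightarrow> real) \<Rightarrow> com \<Rightarrow> (nat \<Rightarrow> state \<Rightarrow> bool) \<Rightarrow> state \<Rightarrow> bool" where
  "wp g A Q s \<longleftrightarrow> (\<exists>n t. exec g A s n t \<and> Q n t)"

lemma wp_mono:
  assumes "wp g A P s" and "\<And>n t. P n t \<Longrightarrow> Q n t"
  shows "wp g A Q s"
  using assms unfolding wp_def by blast

lemma wp_iff:
  assumes "exec g A s n t"
  shows "wp g A Q s \<longleftrightarrow> Q n t"
  using assms exec_deterministic unfolding wp_def by blast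

lemmas wp_basic [simp] =
  wp_iff[OF exec.IAssign] wp_iff[OF exec.RAssign] wp_iff[OF exec.RStore] wp_iff[OF exec.Query]

lemma wp_Seq [simp]:
  "wp g (Seq A B) Q s \<longleftrightarrow> wp g A (\<lambda>k. wp g B (\<lambda>l. Q (k + l))) s"
  unfolding wp_def by (blast elim: exec_SeqE intro: exec.Seq)

lemma wp_If [simp]:
  "wp g (If b A B) Q s \<longleftrightarrow>
     (if bval b s then wp g A (\<lambda>k. Q (1 + bcost b + k)) s
      else wp g B (\<lambda>k. Q (1 + bcost b + k)) s)"
proof (cases "bval b s")
  case True
  have "exec g (If b A B) s n t \<longleftrightarrow> (\<exists>k. n = 1 + bcost b + k \<and> exec g A s k t)" for n t
    using True by (auto elim: exec_IfE intro: exec.IfTrue[simplified])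
  with True show ?thesis unfolding wp_def by auto
next
  case False
  have "exec g (If b A B) s n t \<longleftrightarrow> (\<exists>k. n = 1 + bcost b + k \<and> exec g B s k t)" for n t
    using False by (auto elim: exec_IfE intro: exec.IfFalse[simplified])
  with False show ?thesis unfolding wp_def by auto
qed

text \<open>The invariant is indexed by the number of completed iterations, and their total
  \<open>n\<close> is fixed in advance. Termination and the time bound thus come from the same
  count, without a separate variant.\<close>

lemma wp_While:
  assumes init: "I 0 s"
    and step: "\<And>i s. i < n \<Longrightarrow> I i s \<Longrightarrow> bval b s \<and> wp g A (\<lambda>k t. k \<le> K \<and> I (Suc i) t) s"
    and exit: "\<And>s. I n s \<Longrightarrow> \<not> bval b s"
  shows "wp g (While b A) (\<lambda>k t. k \<le> n * (1 + bcost b + K) + (1 + bcost b) \<and> I n t) s"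
proof -
  \<comment> \<open>Here \<open>d\<close> is the number of iterations still to be done.\<close>
  have "wp g (While b A) (\<lambda>k t. k \<le> d * (1 + bcost b + K) + (1 + bcost b) \<and> I n t) s"
    if "I (n - d) s" "d \<le> n" for d s
    using that
  proof (induction d arbitrary: s)
    case 0
    with exit have "\<not> bval b s" by simp
    then show ?case using 0 exec.WhileFalse[of b s g A] by (auto simp: wp_def)
  next
    case (Suc d)
    from step[of "n - Suc d" s] Suc.prems obtain k t where
      b: "bval b s" and ex: "exec g A s k t" and k: "k \<le> K" and I: "I (n - d) t"
      by (auto simp: wp_def Suc_diff_Suc)
    from Suc.IH[OF I] Suc.prems obtain l u where
      "exec g (While b A) t l u" "l \<le> d * (1 + bcost b + K) + (1 + bcost b)" "I n u"
      by (auto simp: wp_def)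
    with exec.WhileTrue[OF b ex] k show ?case
      unfolding wp_def by fastforce
  qed
  from this[of n s] init show ?thesis by simp
qed


section \<open>Extrapolation to zero by finite differences\<close>

definition altbin :: "nat \<Rightarrow> nat \<Rightarrow> real" where
  "altbin n j = (-1) ^ j * real (n choose j)"

lemma altbin_0 [simp]: "altbin n 0 = 1"
  by (simp add: altbin_def)

text \<open>Absorption relates neighbouring binomial coefficients. The recurrence lets a program
  produce all of them in turn with a constant number of real operations each.\<close>

lemma altbin_Suc: "altbin n (Suc j) = - altbin n j * (real n - real j) / (real j + 1)"
proof (cases "j \<le> n")
  case True
  have "Suc j * (n choose Suc j) = (n - j) * (n choose j)"
    by (simp only: binomial_absorb_comp binomial_absorption)
  then have "real (Suc j * (n choose Suc j)) = real ((n - j) * (n choose j))"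
    by (rule arg_cong)
  then have "(real j + 1) * real (n choose Suc j) = (real n - real j) * real (n choose j)"
    using True by (simp add: of_nat_diff algebra_simps)
  then have "(-1) ^ Suc j * ((real j + 1) * real (n choose Suc j)) =
      (-1) ^ Suc j * ((real n - real j) * real (n choose j))"
    by (rule arg_cong)
  then show ?thesis
    by (simp add: altbin_def nonzero_eq_divide_eq mult_ac)
next
  case False
  then show ?thesis by (simp add: altbin_def binomial_eq_0)
qed

text \<open>Up to sign, the sum is the \<open>n\<close>-th finite difference of \<open>p\<close> at
  \<open>0\<close>. Pascal's rule reduces order \<open>Suc n\<close> for \<open>p\<close> to order
  \<open>n\<close> for the first difference of \<open>p\<close>, whose degree is smaller.\<close>

lemma alternating_binomial_sum_poly:
  fixes p :: "real poly"
  assumes "degree p < n"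
  shows "(\<Sum>j\<le>n. altbin n j * poly p (real j)) = 0"
  using assms
proof (induction n arbitrary: p)
  case 0
  then show ?case by simp
next
  case (Suc n)
  define d where "d = p - pcompose p [:1, 1:]"
  have pd: "poly d (real j) = poly p (real j) - poly p (real (Suc j))" for j
    by (simp add: d_def poly_pcompose add.commute)
  have alt: "altbin (Suc n) (Suc j) = altbin n (Suc j) - altbin n j" for j
    by (simp add: altbin_def algebra_simps)
  have "(\<Sum>j\<le>Suc n. altbin (Suc n) j * poly p (real j)) =
      poly p 0 + (\<Sum>j\<le>n. altbin n (Suc j) * poly p (real (Suc j)))
        - (\<Sum>j\<le>n. altbin n j * poly p (real (Suc j)))"
    unfolding sum.atMost_Suc_shift alt by (simp add: algebra_simps sum_subtractf)
  also have "poly p 0 + (\<Sum>j\<le>n. altbin n (Suc j) * poly p (real (Suc j))) =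
      (\<Sum>j\<le>Suc n. altbin n j * poly p (real j))"
    unfolding sum.atMost_Suc_shift[of _ n] by simp
  \<comment> \<open>The top term vanishes because \<open>n choose Suc n\<close> is zero.\<close>
  also have "\<dots> = (\<Sum>j\<le>n. altbin n j * poly p (real j))"
    by (simp add: altbin_def)
  also have "\<dots> - (\<Sum>j\<le>n. altbin n j * poly p (real (Suc j))) =
      (\<Sum>j\<le>n. altbin n j * poly d (real j))"
    by (simp add: pd algebra_simps sum_subtractf)
  also have "\<dots> = 0"
  \<comment> \<open>A constant \<open>p\<close> is separated: its difference is zero, but its degree
    cannot drop, so for \<open>n = 0\<close> the induction hypothesis would not apply.\<close>
  proof (cases "degree p = 0")
    case True
    then obtain a where "p = [:a:]" by (metis degree_eq_zeroE)
    then show ?thesis by (simp add: d_def pcompose_pCons)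
  next
    case False
    \<comment> \<open>Translating the argument keeps degree and leading coefficient, so the leading
      terms cancel in \<open>d\<close>.\<close>
    have "coeff (pcompose p [:1, 1:]) (degree p) = lead_coeff p"
      using lead_coeff_comp[of "[:1, 1:] :: real poly" p] by (simp add: degree_pcompose)
      then have "coeff d i = 0" if "i > degree p - 1" for i
      using that False
      by (cases "i = degree p") (auto simp: d_def coeff_eq_0 degree_pcompose)
    then have "degree d \<le> degree p - 1"
      by (intro degree_le) simp
    with Suc False show ?thesis by auto
  qed
  finally show ?case .
qed

lemma poly_0_by_extrapolation:
  fixes p :: "real poly"
  assumes "degree p < n"
  shows "poly p 0 = - (\<Sum>j=1..n. altbin n j * poly p (real j))"
proof -
  have "{..n} = insert 0 {1..n}" by auto
  then show ?thesis using alternating_binomial_sum_poly[OF assms] by simp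
qed

text \<open>One Horner step. Solved for the last factor at \<open>x \<noteq> 0\<close>, it is the
  deflation: subtract the constant coefficient and divide by \<open>x\<close>.\<close>

lemma poly_poly_shift:
  fixes p :: "real poly"
  shows "poly (poly_shift k p) x = coeff p k + x * poly (poly_shift (Suc k) p) x"
proof -
  have "poly_shift k p = pCons (coeff p k) (poly_shift (Suc k) p)"
    by (intro poly_eqI) (auto simp: coeff_pCons coeff_poly_shift split: nat.split)
  then show ?thesis by simp
qed

text \<open>Because of this the same sample points suffice in every round of deflation.\<close>

lemma degree_poly_shift_le: "degree (poly_shift k p) \<le> degree p"
  by (intro degree_le) (auto simp: coeff_poly_shift coeff_eq_0)


section \<open>The weight enumerator\<close>

text \<open>This is the polynomial \<open>q\<close>. Adding the norm makes every exponent
  nonnegative, so \<open>nat\<close> truncates nothing.\<close>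

definition weight_poly :: "nat \<Rightarrow> (nat set \<Rightarrow> real) \<Rightarrow> (nat \<Rightarrow> int) \<Rightarrow> real poly" where
  "weight_poly m \<mu> c =
     (\<Sum>S\<in>Pow {1..m}. monom (\<mu> S) (nat (int (l1_norm m c) + (\<Sum>i\<in>S. c i))))"

lemma abs_sum_le_l1_norm:
  assumes "S \<subseteq> {1..m}"
  shows "\<bar>\<Sum>i\<in>S. c i\<bar> \<le> int (l1_norm m c)"
proof -
  have "\<bar>\<Sum>i\<in>S. c i\<bar> \<le> (\<Sum>i\<in>S. \<bar>c i\<bar>)" by (rule sum_abs)
  also have "\<dots> \<le> (\<Sum>i=1..m. \<bar>c i\<bar>)" using assms by (intro sum_mono2) auto
  finally show ?thesis by (simp add: l1_norm_def)
qed

lemma degree_weight_poly: "degree (weight_poly m \<mu> c) \<le> 2 * l1_norm m c"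
  unfolding weight_poly_def
proof (intro degree_sum_le)
  fix S assume "S \<in> Pow {1..m}"
  then have "nat (int (l1_norm m c) + (\<Sum>i\<in>S. c i)) \<le> 2 * l1_norm m c"
    using abs_sum_le_l1_norm[of S m c] by simp
  then show "degree (monom (\<mu> S) (nat (int (l1_norm m c) + (\<Sum>i\<in>S. c i)))) \<le> 2 * l1_norm m c"
    using degree_monom_le order_trans by blast
qed simp

lemma prod_power_int:
  fixes z :: real
  assumes "z \<noteq> 0"
  shows "(\<Prod>i\<in>S. z powi c i) = z powi (\<Sum>i\<in>S. c i)"
  using assms by (induction S rule: infinite_finite_induct) (auto simp: power_int_add)

text \<open>The factor \<open>z ^ l1_norm m c\<close> clears the negative powers of
  \<open>z\<close>. The point \<open>x\<close> is prescribed on \<open>{1..m}\<close> only, since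
  nothing is claimed about the other entries of the queried array.\<close>

lemma poly_weight_poly:
  assumes "z \<noteq> 0" and x: "\<And>i. i \<in> {1..m} \<Longrightarrow> x i = z powi c i"
  shows "poly (weight_poly m \<mu> c) z = z ^ l1_norm m c * gen_poly m \<mu> x"
proof -
  have "z ^ nat (int (l1_norm m c) + (\<Sum>i\<in>S. c i)) = z ^ l1_norm m c * (\<Prod>i\<in>S. x i)"
    if "S \<subseteq> {1..m}" for S
  proof -
    have "(\<Prod>i\<in>S. x i) = (\<Prod>i\<in>S. z powi c i)" using x that by (intro prod.cong) auto
    then have "z ^ l1_norm m c * (\<Prod>i\<in>S. x i) = z powi (int (l1_norm m c) + (\<Sum>i\<in>S. c i))"
      using assms by (simp add: prod_power_int power_int_add)
    then show ?thesis
      using abs_sum_le_l1_norm[OF that, of c] by (simp add: power_int_def)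
  qed
  then show ?thesis
    by (auto simp: weight_poly_def gen_poly_def poly_sum poly_monom sum_distrib_left
        intro!: sum.cong)
qed

text \<open>After exchanging the sums, each \<open>S\<close> contributes at its one shifted weight.
  The cutoff \<open>R\<close> has to agree with \<open>C\<close> only on weights bounded by the
  norm, so it can be clamped when \<open>C\<close> lies far outside that range.\<close>

lemma sum_coeff_weight_poly:
  assumes "\<And>k :: int. \<bar>k\<bar> \<le> int (l1_norm m c) \<Longrightarrow> k \<le> C \<longleftrightarrow> k + int (l1_norm m c) < int R"
  shows "(\<Sum>r<R. coeff (weight_poly m \<mu> c) r) = BCount m \<mu> c C"
proof -
  have "(\<Sum>r<R. coeff (weight_poly m \<mu> c) r) =
      (\<Sum>S\<in>Pow {1..m}. \<Sum>r<R. if nat (int (l1_norm m c) + (\<Sum>i\<in>S. c i)) = r then \<mu> S else 0)"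
    unfolding weight_poly_def coeff_sum coeff_monom by (rule sum.swap)
  also have "\<dots> = (\<Sum>S\<in>Pow {1..m}. if (\<Sum>i\<in>S. c i) \<le> C then \<mu> S else 0)"
  proof (intro sum.cong refl)
    fix S assume "S \<in> Pow {1..m}"
    with abs_sum_le_l1_norm[of S m c] assms[of "\<Sum>i\<in>S. c i"]
    show "(\<Sum>r<R. if nat (int (l1_norm m c) + (\<Sum>i\<in>S. c i)) = r then \<mu> S else 0) =
        (if (\<Sum>i\<in>S. c i) \<le> C then \<mu> S else 0)"
      by auto
  qed
  also have "\<dots> = BCount m \<mu> c C"
    unfolding BCount_def by (simp add: sum.inter_filter[symmetric] Pow_def)
  finally show ?thesis .
qed


section \<open>The program and its verification\<close>

definition norm_prog :: com where
  "norm_prog =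
     Seq (IAssign ''i'' (INum 1)) (Seq (IAssign ''N'' (INum 0))
       (While (ILess (IVar ''i'') (IAdd (IVar ''m'') (INum 1)))
         (Seq (If (ILess (IArr ''c'' (IVar ''i'')) (INum 0))
                (IAssign ''N'' (ISub (IVar ''N'') (IArr ''c'' (IVar ''i''))))
                (IAssign ''N'' (IAdd (IVar ''N'') (IArr ''c'' (IVar ''i'')))))
              (IAssign ''i'' (IAdd (IVar ''i'') (INum 1))))))"

text \<open>Powers are formed by repeated multiplication by \<open>z\<close> or
  \<open>1 / z\<close>. Alongside, \<open>w\<close> collects the absolute exponents, so that after
  all coordinates it is the factor that clears the denominators.\<close>

definition power_prog :: com where
  "power_prog =
     Seq (RAssign ''u'' (RNum 1))
       (Seq (If (ILess (IArr ''c'' (IVar ''i'')) (INum 0))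
              (Seq (IAssign ''h'' (ISub (INum 0) (IArr ''c'' (IVar ''i''))))
                (RAssign ''r'' (RDiv (RNum 1) (RVar ''z''))))
              (Seq (IAssign ''h'' (IArr ''c'' (IVar ''i'')))
                (RAssign ''r'' (RVar ''z''))))
         (While (ILess (INum 0) (IVar ''h''))
           (Seq (RAssign ''u'' (RMul (RVar ''u'') (RVar ''r'')))
             (Seq (RAssign ''w'' (RMul (RVar ''w'') (RVar ''z'')))
               (IAssign ''h'' (ISub (IVar ''h'') (INum 1)))))))"

definition point_prog :: com where
  "point_prog =
     Seq (IAssign ''i'' (INum 1)) (Seq (RAssign ''w'' (RNum 1))
       (While (ILess (IVar ''i'') (IAdd (IVar ''m'') (INum 1)))
         (Seq power_prog
           (Seq (RStore ''x'' (IVar ''i'') (RVar ''u''))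
             (IAssign ''i'' (IAdd (IVar ''i'') (INum 1)))))))"

definition sample_prog :: com where
  "sample_prog =
     Seq (IAssign ''j'' (INum 1)) (Seq (RAssign ''z'' (RNum 1))
       (While (ILess (IVar ''j'') (IAdd (IAdd (IVar ''N'') (IVar ''N'')) (INum 2)))
         (Seq point_prog
           (Seq (Query ''q'' ''x'')
             (Seq (RStore ''v'' (IVar ''j'') (RMul (RVar ''w'') (RVar ''q'')))
               (Seq (IAssign ''j'' (IAdd (IVar ''j'') (INum 1)))
                 (RAssign ''z'' (RAdd (RVar ''z'') (RNum 1)))))))))"

text \<open>There is no conversion from integers to reals, so real counters run in parallel to the integer
  ones. Sampling leaves \<open>2N + 2\<close> in \<open>z\<close>, which the recurrence for the signed binomial
  coefficients \<open>b\<close> below needs.\<close>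

definition extrapolate_prog :: com where
  "extrapolate_prog =
     Seq (IAssign ''j'' (INum 1)) (Seq (RAssign ''y'' (RNum 1))
       (Seq (RAssign ''b'' (RNum 1)) (Seq (RAssign ''e'' (RNum 0))
         (While (ILess (IVar ''j'') (IAdd (IAdd (IVar ''N'') (IVar ''N'')) (INum 2)))
           (Seq (RAssign ''b'' (RDiv (RMul (RSub (RNum 0) (RVar ''b''))
                    (RSub (RVar ''z'') (RVar ''y''))) (RVar ''y'')))
             (Seq (RAssign ''e'' (RSub (RVar ''e'')
                      (RMul (RVar ''b'') (RArr ''v'' (IVar ''j'')))))
               (Seq (IAssign ''j'' (IAdd (IVar ''j'') (INum 1)))
                 (RAssign ''y'' (RAdd (RVar ''y'') (RNum 1))))))))))"

definition deflate_prog :: com where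
  "deflate_prog =
     Seq (IAssign ''j'' (INum 1)) (Seq (RAssign ''y'' (RNum 1))
       (While (ILess (IVar ''j'') (IAdd (IAdd (IVar ''N'') (IVar ''N'')) (INum 2)))
         (Seq (RStore ''v'' (IVar ''j'')
                (RDiv (RSub (RArr ''v'' (IVar ''j'')) (RVar ''e'')) (RVar ''y'')))
           (Seq (IAssign ''j'' (IAdd (IVar ''j'') (INum 1)))
             (RAssign ''y'' (RAdd (RVar ''y'') (RNum 1)))))))"

text \<open>The loop is also bounded by \<open>N\<close>, because \<open>C\<close> may be arbitrarily large.\<close>

definition extract_prog :: com where
  "extract_prog =
     Seq (IAssign ''k'' (ISub (INum 0) (IVar ''N'')))
       (While (BAnd (ILess (IVar ''k'') (IAdd (IVar ''N'') (INum 1)))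
                 (BNot (ILess (IVar ''C'') (IVar ''k''))))
         (Seq extrapolate_prog
           (Seq deflate_prog
             (Seq (RAssign ''out'' (RAdd (RVar ''out'') (RVar ''e'')))
               (IAssign ''k'' (IAdd (IVar ''k'') (INum 1)))))))"

definition bcount_prog :: com where
  "bcount_prog = Seq norm_prog (Seq sample_prog extract_prog)"

section \<open>Input assumptions and frame conditions\<close>

definition env :: "nat \<Rightarrow> (nat \<Rightarrow> int) \<Rightarrow> state \<Rightarrow> bool" where
  "env m c s \<longleftrightarrow> ivar s ''m'' = int m \<and> (\<forall>i\<in>{1..m}. iarr s ''c'' (int i) = c i)"

text \<open>One set of names serves for variables and arrays of both sorts: the program never uses
  the same name twice.\<close>

definition same_except :: "string set \<Rightarrow> state \<Rightarrow> state \<Rightarrow> bool" where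
  "same_except V s t \<longleftrightarrow> (\<forall>x. x \<notin> V \<longrightarrow>
     ivar t x = ivar s x \<and> iarr t x = iarr s x \<and> rvar t x = rvar s x \<and> rarr t x = rarr s x)"

lemma env_array:
  assumes "env m c s" "r < m"
  shows "iarr s ''c'' (1 + int r) = c (Suc r)"
  using assms unfolding env_def
  by (metis Suc_le_eq atLeastAtMost_iff le_add1 of_nat_Suc plus_1_eq_Suc)

text \<open>Decides whether entry \<open>i\<close> is the one just stored at index
  \<open>int r + 1\<close>.\<close>

lemma int_eq_add_1_iff: "int i = int r + 1 \<longleftrightarrow> i = Suc r"
  by linarith

section \<open>Correctness and cost of computing the norm and sampling \<open>q\<close>\<close>

lemma norm_prog_correct:
  assumes "env m c s"
  shows "wp g norm_prog (\<lambda>k t. k \<le> 30 * (m + 1) \<and>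
      same_except {''i'', ''N''} s t \<and> ivar t ''N'' = int (l1_norm m c)) s"
proof -
  define I where "I r t \<longleftrightarrow> same_except {''i'', ''N''} s t \<and> ivar t ''i'' = int r + 1 \<and>
     ivar t ''N'' = (\<Sum>i=1..r. \<bar>c i\<bar>)" for r t
  have env: "env m c t" if "I r t" for r t
    using that assms by (simp add: I_def same_except_def env_def)
  show ?thesis
    unfolding norm_prog_def
    apply simp
    apply (rule wp_mono)
     apply (rule wp_While[where I = I and n = m and K = 20])
    subgoal by (simp add: I_def same_except_def)
    subgoal premises prems for r t
      using prems env[OF prems(2)] env_array[OF env[OF prems(2)] prems(1)]
      by (simp add: I_def same_except_def env_def add.commute)
    subgoal for t using env[of m t] by (simp add: I_def env_def)
    subgoal by (auto simp: I_def l1_norm_def)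
    done
qed

lemma power_prog_correct:
  assumes c: "iarr s ''c'' (ivar s ''i'') = p" and z: "rvar s ''z'' = z"
  shows "wp g power_prog (\<lambda>k t. k \<le> 16 * nat \<bar>p\<bar> + 40 \<and>
      same_except {''h'', ''r'', ''u'', ''w''} s t \<and> rvar t ''u'' = z powi p \<and>
      rvar t ''w'' = rvar s ''w'' * z ^ nat \<bar>p\<bar>) s"
proof -
  define I where "I r t \<longleftrightarrow> same_except {''h'', ''r'', ''u'', ''w''} s t \<and>
      ivar t ''h'' = \<bar>p\<bar> - int r \<and> rvar t ''r'' = (if p < 0 then 1 / z else z) \<and>
      rvar t ''u'' = (if p < 0 then 1 / z else z) ^ r \<and> rvar t ''w'' = rvar s ''w'' * z ^ r" for r t
  have powi: "(if p < 0 then 1 / z else z) ^ nat \<bar>p\<bar> = z powi p"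
    by (simp add: power_int_def divide_inverse)
  have loop: "wp g (While (ILess (INum 0) (IVar ''h''))
           (Seq (RAssign ''u'' (RMul (RVar ''u'') (RVar ''r'')))
             (Seq (RAssign ''w'' (RMul (RVar ''w'') (RVar ''z'')))
               (IAssign ''h'' (ISub (IVar ''h'') (INum 1))))))
       (\<lambda>k t. k \<le> nat \<bar>p\<bar> * 16 + 4 \<and> I (nat \<bar>p\<bar>) t) t" if "I 0 t" for t
    apply (rule wp_mono)
     \<comment> \<open>The body consists of three assignments of cost 4 each; the test adds 4 per
       round.\<close>
     apply (rule wp_While[where I = I and n = "nat \<bar>p\<bar>" and K = 12, OF that])
    subgoal using z by (auto simp: I_def same_except_def)
    subgoal by (simp add: I_def)
    subgoal by simp
    done
  show ?thesis
    unfolding power_prog_def using powi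
    by (cases "p < 0") (auto intro!: wp_mono[OF loop] simp: I_def same_except_def c z)
qed

lemma point_prog_correct:
  assumes env: "env m c s" and z: "rvar s ''z'' = z"
  shows "wp g point_prog (\<lambda>k t. k \<le> 70 * ((m + 1) * (l1_norm m c + 1)) \<and>
      same_except {''h'', ''r'', ''u'', ''w'', ''i'', ''x''} s t \<and>
      (\<forall>i\<in>{1..m}. rarr t ''x'' (int i) = z powi c i) \<and> rvar t ''w'' = z ^ l1_norm m c) s"
proof -
  define V where "V = {''h'', ''r'', ''u'', ''w'', ''i'', ''x''}"
  define I where "I r t \<longleftrightarrow> same_except V s t \<and> ivar t ''i'' = int r + 1 \<and>
      (\<forall>i\<in>{1..r}. rarr t ''x'' (int i) = z powi c i) \<and>
      rvar t ''w'' = z ^ (\<Sum>i=1..r. nat \<bar>c i\<bar>)" for r t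
  have envI: "env m c t" and zI: "rvar t ''z'' = z" if "I r t" for r t
    using that env z by (simp_all add: I_def V_def same_except_def env_def)
  \<comment> \<open>The loop rule needs one bound for all iterations, so each exponent is estimated
    by the whole norm. This is the source of the product of \<open>m + 1\<close> and
    \<open>l1_norm m c + 1\<close>.\<close>
  have le: "nat \<bar>c (Suc r)\<bar> \<le> l1_norm m c" if "r < m" for r
    unfolding l1_norm_def using that by (intro member_le_sum) auto
  show ?thesis
    unfolding point_prog_def V_def[symmetric]
    apply simp
    apply (rule wp_mono)
     apply (rule wp_While[where I = I and n = m and K = "16 * l1_norm m c + 50"])
    subgoal by (simp add: I_def V_def same_except_def)
    subgoal premises prems for r t
    proof -
      have c: "iarr t ''c'' (ivar t ''i'') = c (Suc r)"
        using prems env_array[OF envI[OF prems(2)] prems(1)] by (simp add: I_def add.commute)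
      show ?thesis
        using prems envI[OF prems(2)] le[OF prems(1)]
        apply (simp add: I_def env_def)
        apply (rule wp_mono[OF power_prog_correct[OF c zI[OF prems(2)]]])
        apply (simp add: V_def same_except_def power_add int_eq_add_1_iff)
        done
    qed
    subgoal for t using envI[of m t] by (simp add: I_def env_def)
    subgoal by (auto simp: I_def l1_norm_def algebra_simps)
    done
qed

lemma sample_prog_correct:
  assumes env: "env m c s" and N: "ivar s ''N'' = int (l1_norm m c)"
  shows "wp (gen_poly m \<mu>) sample_prog
     (\<lambda>k t. k \<le> 300 * ((m + 1) * (l1_norm m c + 1)\<^sup>2) \<and>
      same_except {''h'', ''r'', ''u'', ''w'', ''i'', ''x'', ''j'', ''z'', ''q'', ''v''} s t \<and>
      rvar t ''z'' = 2 * real (l1_norm m c) + 2 \<and>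
      (\<forall>j\<in>{1..2 * l1_norm m c + 1}.
         rarr t ''v'' (int j) = poly (weight_poly m \<mu> c) (real j))) s"
proof -
  define V where "V = {''h'', ''r'', ''u'', ''w'', ''i'', ''x'', ''j'', ''z'', ''q'', ''v''}"
  define P where "P = weight_poly m \<mu> c"
  define N where "N = l1_norm m c"
  define I where "I r t \<longleftrightarrow> same_except V s t \<and> ivar t ''j'' = int r + 1 \<and>
      rvar t ''z'' = real r + 1 \<and> (\<forall>j\<in>{1..r}. rarr t ''v'' (int j) = poly P (real j))" for r t
  have envI: "env m c t" and NI: "ivar t ''N'' = int N" if "I r t" for r t
    using that assms by (simp_all add: I_def V_def N_def same_except_def env_def)
  show ?thesis
    unfolding sample_prog_def V_def[symmetric] P_def[symmetric] N_def[symmetric]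
    apply simp
    apply (rule wp_mono)
     apply (rule wp_While[where I = I and n = "2 * N + 1" and K = "70 * ((m + 1) * (N + 1)) + 20"])
    subgoal by (simp add: I_def V_def same_except_def)
    subgoal premises prems for r t
    proof -
      have z: "rvar t ''z'' = real r + 1" using prems by (simp add: I_def)
      \<comment> \<open>The sample points start at \<open>1\<close>, so the point is nonzero and
        negative powers are legitimate.\<close>
      have val: "(real r + 1) ^ N * gen_poly m \<mu> x = poly P (1 + real r)"
        if "\<forall>i\<in>{1..m}. x i = (real r + 1) powi c i" for x
        using that poly_weight_poly[of "real r + 1" m x c \<mu>] by (simp add: N_def P_def add.commute)
      show ?thesis
        using prems NI[OF prems(2)]
        apply (simp add: I_def)
        apply (rule wp_mono[OF point_prog_correct[OF envI[OF prems(2)] z]])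
        apply (simp add: V_def same_except_def int_eq_add_1_iff val N_def[symmetric])
        done
    qed
    subgoal for t using NI[of "2 * N + 1" t] by (simp add: I_def)
    subgoal by (auto simp: I_def algebra_simps power2_eq_square)
    done
qed

section \<open>Correctness and cost of recovering the lowest coefficients\<close>

lemma extrapolate_prog_correct:
  assumes N: "ivar s ''N'' = int N" and z: "rvar s ''z'' = 2 * real N + 2"
    and v: "\<forall>j\<in>{1..2 * N + 1}. rarr s ''v'' (int j) = poly p (real j)"
    and deg: "degree p \<le> 2 * N"
  shows "wp g extrapolate_prog (\<lambda>k t. k \<le> 100 * (N + 1) \<and>
      same_except {''j'', ''y'', ''b'', ''e''} s t \<and> rvar t ''e'' = poly p 0) s"
proof -
  \<comment> \<open>With \<open>z = 2 * N + 2\<close> and \<open>y = r + 1\<close>, the difference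
    \<open>z - y\<close> is \<open>(2 * N + 1) - r\<close>, the numerator in
    \<open>altbin_Suc\<close>.\<close>
  define I where "I r t \<longleftrightarrow> same_except {''j'', ''y'', ''b'', ''e''} s t \<and>
      ivar t ''j'' = int r + 1 \<and> rvar t ''y'' = real r + 1 \<and>
      rvar t ''b'' = altbin (2 * N + 1) r \<and>
      rvar t ''e'' = - (\<Sum>j=1..r. altbin (2 * N + 1) j * poly p (real j))" for r t
  have vI: "rarr t ''v'' (1 + int r) = poly p (1 + real r)" if "I r t" "r < 2 * N + 1" for r t
    using that bspec[OF v, of "Suc r"] by (simp add: I_def same_except_def)
  have final: "poly p 0 = - (\<Sum>j=1..2 * N + 1. altbin (2 * N + 1) j * poly p (real j))"
    using deg by (intro poly_0_by_extrapolation) simp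
  show ?thesis
    unfolding extrapolate_prog_def
    apply simp
    apply (rule wp_mono)
     apply (rule wp_While[where I = I and n = "2 * N + 1" and K = 30])
    subgoal by (simp add: I_def same_except_def)
    subgoal premises prems for r t
      using prems vI[OF prems(2,1)] N z
      by (simp add: I_def same_except_def altbin_Suc add.commute)
    subgoal using N by (simp add: I_def same_except_def)
    subgoal unfolding final by (simp add: I_def)
    done
qed

lemma deflate_prog_correct:
  assumes N: "ivar s ''N'' = int N"
  shows "wp g deflate_prog (\<lambda>k t. k \<le> 100 * (N + 1) \<and>
      same_except {''j'', ''y'', ''v''} s t \<and>
      (\<forall>j\<in>{1..2 * N + 1}.
         rarr t ''v'' (int j) = (rarr s ''v'' (int j) - rvar s ''e'') / real j)) s"
proof -
  \<comment> \<open>The array is overwritten in place, so the invariant also records that later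
    entries still hold their old values.\<close>
  define I where "I r t \<longleftrightarrow> same_except {''j'', ''y'', ''v''} s t \<and>
      ivar t ''j'' = int r + 1 \<and> rvar t ''y'' = real r + 1 \<and>
      (\<forall>j. rarr t ''v'' (int j) =
         (if 1 \<le> j \<and> j \<le> r then (rarr s ''v'' (int j) - rvar s ''e'') / real j
          else rarr s ''v'' (int j)))" for r t
  have vI: "rarr t ''v'' (1 + int r) = rarr s ''v'' (1 + int r)" if "I r t" for r t
  proof -
    have "rarr t ''v'' (int (Suc r)) = rarr s ''v'' (int (Suc r))"
      using that unfolding I_def by (metis not_less_eq_eq order_refl)
    then show ?thesis by simp
  qed
  show ?thesis
    unfolding deflate_prog_def
    apply simp
    apply (rule wp_mono)
     apply (rule wp_While[where I = I and n = "2 * N + 1" and K = 30])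
    subgoal by (simp add: I_def same_except_def)
    subgoal premises prems for r t
      using prems vI[OF prems(2)] N
      by (auto simp add: I_def same_except_def add.commute le_Suc_eq)
    subgoal using N by (simp add: I_def same_except_def)
    subgoal by (simp add: I_def)
    done
qed

lemma extract_prog_correct:
  assumes N: "ivar s ''N'' = int N" and z: "rvar s ''z'' = 2 * real N + 2"
    and v: "\<forall>j\<in>{1..2 * N + 1}. rarr s ''v'' (int j) = poly p (real j)"
    and deg: "degree p \<le> 2 * N" and out: "rvar s ''out'' = 0" and C: "ivar s ''C'' = C"
  shows "wp g extract_prog (\<lambda>k t. k \<le> 600 * (N + 1)\<^sup>2 \<and>
      rvar t ''out'' = (\<Sum>i<nat (min (2 * int N + 1) (C + int N + 1)). coeff p i)) s"
proof -
  define V where "V = {''j'', ''y'', ''b'', ''e'', ''v'', ''k'', ''out''}"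
  \<comment> \<open>The number of rounds: \<open>k\<close> runs from \<open>- N\<close> to the
    smaller of \<open>N\<close> and \<open>C\<close>. If \<open>C < - N\<close>, then
    \<open>nat\<close> yields no round at all.\<close>
  define R where "R = nat (min (2 * int N + 1) (C + int N + 1))"
  \<comment> \<open>After \<open>r\<close> rounds the samples are those of \<open>p\<close> with its
    \<open>r\<close> lowest coefficients removed and \<open>r\<close> powers of the variable divided
    out.\<close>
  define I where "I r t \<longleftrightarrow> same_except V s t \<and> ivar t ''k'' = int r - int N \<and>
      rvar t ''out'' = (\<Sum>i<r. coeff p i) \<and>
      (\<forall>j\<in>{1..2 * N + 1}. rarr t ''v'' (int j) = poly (poly_shift r p) (real j))" for r t
  have R: "R \<le> 2 * N + 1" by (simp add: R_def)
  have NI: "ivar t ''N'' = int N" and zI: "rvar t ''z'' = 2 * real N + 2"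
    and CI: "ivar t ''C'' = C" if "I r t" for r t
    using that assms by (simp_all add: I_def V_def same_except_def)
  show ?thesis
    unfolding extract_prog_def R_def[symmetric]
    apply simp
    apply (rule wp_mono)
     apply (rule wp_While[where I = I and n = R and K = "200 * (N + 1) + 20"])
    subgoal using assms by (simp add: I_def V_def same_except_def)
    subgoal premises prems for r t
    proof -
      have vI: "\<forall>j\<in>{1..2 * N + 1}. rarr t ''v'' (int j) = poly (poly_shift r p) (real j)"
        using prems by (simp add: I_def)
      have deg': "degree (poly_shift r p) \<le> 2 * N"
        using degree_poly_shift_le deg by (rule order_trans)
      have p0: "poly (poly_shift r p) 0 = coeff p r"
        by (simp add: poly_0_coeff_0 coeff_poly_shift)
      show ?thesis
        using prems NI[OF prems(2)] CI[OF prems(2)]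
        apply (simp add: I_def)
        apply (intro conjI)
          apply (simp add: R_def)
         apply (simp add: R_def)
        apply (rule wp_mono[OF extrapolate_prog_correct
              [OF NI[OF prems(2)] zI[OF prems(2)] vI deg']])
        apply (subst wp_Seq)
        apply (rule wp_mono[OF deflate_prog_correct[where N = N]])
         apply (simp_all add: same_except_def)
        using vI
        \<comment> \<open>Subtracting \<open>coeff p r\<close> and dividing by the nonzero
          \<open>real j\<close> turns a value of \<open>poly_shift r p\<close> into one of
          \<open>poly_shift (Suc r) p\<close>.\<close>
        apply (auto simp: V_def same_except_def p0 poly_poly_shift[of r])
        done
    qed
    subgoal for t using NI[of R t] CI[of R t] by (auto simp: I_def R_def min_def split: if_splits)
    subgoal for k t
      using mult_right_mono[OF R, of "1 + 8 + (200 * (N + 1) + 20)"]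
      by (auto simp: I_def algebra_simps power2_eq_square)
    done
qed

section \<open>Composition of the phases and the total time bound\<close>

lemma bcount_prog_correct:
  "wp (gen_poly m \<mu>) bcount_prog (\<lambda>k t. k \<le> 1000 * ((m + 1) * (l1_norm m c + 1)\<^sup>2) \<and>
     result t = BCount m \<mu> c C) (input_state m c C)"
proof -
  define s where "s = input_state m c C"
  define N where "N = l1_norm m c"
  define P where "P = weight_poly m \<mu> c"
  have env: "env m c s" and out: "rvar s ''out'' = 0" and C: "ivar s ''C'' = C"
    by (auto simp: s_def env_def input_state_def)
  have deg: "degree P \<le> 2 * N" by (simp add: P_def N_def degree_weight_poly)
  have sum: "(\<Sum>i<nat (min (2 * int N + 1) (C + int N + 1)). coeff P i) = BCount m \<mu> c C"
    unfolding P_def by (rule sum_coeff_weight_poly) (auto simp: N_def)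
  have time: "30 * (m + 1) + (300 * ((m + 1) * (N + 1)\<^sup>2) + 600 * (N + 1)\<^sup>2)
      \<le> 1000 * ((m + 1) * (N + 1)\<^sup>2)"
    by (simp add: algebra_simps power2_eq_square)
  show ?thesis
    unfolding bcount_prog_def wp_Seq s_def[symmetric] N_def[symmetric]
  proof (rule wp_mono[OF norm_prog_correct[OF env]], elim conjE)
    fix k1 t1
    assume 1: "k1 \<le> 30 * (m + 1)" "same_except {''i'', ''N''} s t1"
      "ivar t1 ''N'' = int (l1_norm m c)"
    from 1 env have "env m c t1" by (simp add: same_except_def env_def)
    from sample_prog_correct[OF this 1(3), of \<mu>]
    show "wp (gen_poly m \<mu>) sample_prog (\<lambda>k. wp (gen_poly m \<mu>) extract_prog
        (\<lambda>l t. k1 + (k + l) \<le> 1000 * ((m + 1) * (N + 1)\<^sup>2) \<and> result t = BCount m \<mu> c C)) t1"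
    proof (rule wp_mono, elim conjE)
      fix k2 t2
      assume 2: "k2 \<le> 300 * ((m + 1) * (l1_norm m c + 1)\<^sup>2)"
        "same_except {''h'', ''r'', ''u'', ''w'', ''i'', ''x'', ''j'', ''z'', ''q'', ''v''} t1 t2"
        "rvar t2 ''z'' = 2 * real (l1_norm m c) + 2"
        "\<forall>j\<in>{1..2 * l1_norm m c + 1}.
           rarr t2 ''v'' (int j) = poly (weight_poly m \<mu> c) (real j)"
      have N: "ivar t2 ''N'' = int N" "rvar t2 ''out'' = 0" "ivar t2 ''C'' = C"
        using 1 2 out C by (simp_all add: same_except_def N_def)
      show "wp (gen_poly m \<mu>) extract_prog
          (\<lambda>l t. k1 + (k2 + l) \<le> 1000 * ((m + 1) * (N + 1)\<^sup>2) \<and> result t = BCount m \<mu> c C) t2"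
      proof (rule wp_mono[OF extract_prog_correct[OF N(1) _ _ deg N(2,3)]])
        show "rvar t2 ''z'' = 2 * real N + 2" using 2(3) by (simp only: N_def)
        show "\<forall>j\<in>{1..2 * N + 1}. rarr t2 ''v'' (int j) = poly P (real j)"
          using 2(4) by (simp only: N_def P_def)
        fix l :: nat and t :: state
        assume 3: "l \<le> 600 * (N + 1)\<^sup>2 \<and>
          rvar t ''out'' = (\<Sum>i<nat (min (2 * int N + 1) (C + int N + 1)). coeff P i)"
        have "k1 + (k2 + l) \<le> 30 * (m + 1) + (300 * ((m + 1) * (N + 1)\<^sup>2) + 600 * (N + 1)\<^sup>2)"
          using 1(1) 2(1) 3 unfolding N_def by (intro add_mono) blast+
        from order_trans[OF this time] 3
        show "k1 + (k2 + l) \<le> 1000 * ((m + 1) * (N + 1)\<^sup>2) \<and> result t = BCount m \<mu> c C"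
          by (simp only: result_def sum)
      qed
    qed
  qed
qed

theorem theorem1p1:
  "\<exists>(A :: com) (p :: nat poly poly).
     \<forall>(m :: nat) (\<mu> :: nat set \<Rightarrow> real) (c :: nat \<Rightarrow> int) (C :: int).
       \<exists>n t. exec (gen_poly m \<mu>) A (input_state m c C) n t
           \<and> result t = BCount m \<mu> c C
           \<and> n \<le> poly2 p m (l1_norm m c)"
proof -
  \<comment> \<open>The outer variable stands for \<open>m\<close> and the inner one for the norm:
    \<open>[:1, 1:]\<close> becomes \<open>m + 1\<close>, while \<open>[:[:1, 1:]:]\<close> is
    constant in \<open>m\<close> and becomes \<open>N + 1\<close>.\<close>
  define p :: "nat poly poly" where "p = [:[:1000:]:] * ([:1, 1:] * [:[:1, 1:]:]\<^sup>2)"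
  have "poly2 p m N = 1000 * ((m + 1) * (N + 1)\<^sup>2)" for m N
    by (simp add: p_def poly2_def add.commute)
  then have "\<exists>n t. exec (gen_poly m \<mu>) bcount_prog (input_state m c C) n t
      \<and> result t = BCount m \<mu> c C \<and> n \<le> poly2 p m (l1_norm m c)" for m \<mu> c C
    using bcount_prog_correct[of m \<mu> c C] unfolding wp_def by auto
  then show ?thesis by blast
qed

end
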